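(* Let $S$ be a finite alphabet and $F_S$ the sequential cellular automaton of radius $\frac12$ over $\Sigma_S$ described in the context. For every $n\ge1$ and every $x\in S^n$ having a symbol $s\in S$ in strict majority (i.e. $|x|_s>|x|_t$ for every $t\in S\setminus\{s\}$), there exists $K$ such that $F_S^k(x)=s^n$ for all $k\ge K$, and $s^n$ is a fixed point of $F_S$. (That is, $F_S$ solves the density classification task over $S$ using an intermediate alphabet.) This holds for any choice of the unspecified values in rule (R5).
   Context: $S$ is a finite set, $X\notin S$ a new symbol, and $|x|_t$ the number of positions of $x\in S^n$ equal to $t$. The alphabet is $\Sigma_S=S\cup(\{\circ,\bullet\}\times(S\cup\{X\})\times 2^S)$, where $2^S$ is the power set of $S$; a triple $(c,v,M)$ is an intermediate symbol with counter $c$, value $v$ and memory $M$; $\bar c$ is the other counter symbol. Local rule $f_S:\Sigma_S\times\Sigma_S\to\Sigma_S$, $f_S(a,y)$ with $a$ the left neighbour and $y$ the updated cell: (R1) $f_S(s,s)=s$ for $s\in S$; (R2) $f_S(s,s')=(\circ,X,\{s'\})$ for $s\neq s'$ in $S$; (R3) for $t\in S$: $f_S((c,v,M),t)=(c,X,M\cup\{t\})$ if $t\notin M$, $=(c,t,M)$ if $t\in M$; (R4) for $c'\neq c$: $f_S((c,v,M),(c',w,M'))=(c,X,M\cup\{w\})$ if $w\in S\setminus M$, $=(c,w,M)$ if $w\in M\cup\{X\}$; (R5) $f_S((c,v,M),(c,w,M'))=(\bar c,X,\emptyset)$ if $|M|\ge2$; $=t$ if $M=\{t\}$; an arbitrary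 fixed element of $\Sigma_S$ if $M=\emptyset$; (R6) $f_S(t,(c,v,M))=t$ for $t\in S$. Configurations $z\in\Sigma_S^n$ are cyclic with cells $1,\dots,n$, the left neighbour of cell $1$ being cell $n$. One application of $F_S$ performs, for $i=1,\dots,n$ in this order, $z_i:=f_S(z_{i-1},z_i)$ (with $z_0:=z_n$), using current values. $F_S^k$ is $k$ applications of $F_S$. *)

theory Defs
  imports Main
begin

datatype counter = White | Black

fun other :: "counter \<Rightarrow> counter" where
  "other White = Black"
| "other Black = White"

(* The counter symbols are White (empty circle) and Black (filled circle).
   The alphabet is Sigma_S, where S is the (finite) type 's.  In Inter c v M, the value v ranges
   over S together with a new symbol X: None stands for X, Some t for t in S. *)
datatype 's symb = Letter 's | Inter counter "'s option" "'s set"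

(* The argument e supplies the unspecified values: two intermediate symbols with the same
   counter c, the left one with empty memory, are mapped to e c v w M', where v is the value
   of the left symbol and w, M' are the value and memory of the updated one. *)
fun local_rule ::
  "(counter \<Rightarrow> 's option \<Rightarrow> 's option \<Rightarrow> 's set \<Rightarrow> 's symb) \<Rightarrow> 's::finite symb \<Rightarrow> 's symb \<Rightarrow> 's symb"
where
  "local_rule e (Letter s) (Letter t) =
     (if s = t then Letter s else Inter White None {t})"
| "local_rule e (Inter c v M) (Letter t) =
     (if t \<notin> M then Inter c None (M \<union> {t}) else Inter c (Some t) M)"
| "local_rule e (Inter c v M) (Inter c' w M') =
     (if c' \<noteq> c then
        (case w of
           None \<Rightarrow> Inter c None M
         | Some u \<Rightarrow> if u \<notin> M then Inter c None (M \<union> {u}) else Inter c (Some u) M)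
      else if card M \<ge> 2 then Inter (other c) None {}
      else if card M = 1 then Letter (the_elem M)
      else e c v w M')"
| "local_rule e (Letter t) (Inter c v M) = Letter t"

(* Cells are numbered from 0, so the left neighbour of cell 0 is the last cell. *)
definition update_cell :: "('a \<Rightarrow> 'a \<Rightarrow> 'a) \<Rightarrow> nat \<Rightarrow> 'a list \<Rightarrow> 'a list" where
  "update_cell f i z = z[i := f (z ! (if i = 0 then length z - 1 else i - 1)) (z ! i)]"

definition sequential_ca :: "('a \<Rightarrow> 'a \<Rightarrow> 'a) \<Rightarrow> 'a list \<Rightarrow> 'a list" where
  "sequential_ca f z = fold (update_cell f) [0..<length z] z"

end

(* Reading the cyclic configuration from the cell that is updated next, one update removes the
   first cell and appends its new symbol at the end, so the last symbol acts as a moving head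
   carrying a counter and a memory.  The head is created at the first cell that differs from its
   left neighbour.  In each round trip it erases exactly one occurrence of every letter that is
   still present and collects these letters in its memory.  Thus after k + 1 rounds the memory is
   the set of letters occurring more than k times in x, and a letter t survives |x|_t - (k + 1)
   times.  The strict majority letter s outlives all the others, so in some round the memory is
   {s}; the head then becomes the letter s, which overwrites everything. *)
theory Submission
  imports Defs
begin

section \<open>Sequential updates as steps of a queue\<close>

definition queue_step :: "('a \<Rightarrow> 'a \<Rightarrow> 'a) \<Rightarrow> 'a list \<Rightarrow> 'a list" where
  "queue_step f L = tl L @ [f (last L) (hd L)]"

lemma queue_step_Cons [simp]: "queue_step f (a # L) = L @ [f (last (a # L)) a]"
  by (simp add: queue_step_def)

lemma length_update_cell [simp]: "length (update_cell f i z) = length z"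
  by (simp add: update_cell_def)

lemma length_fold_update_cell [simp]: "length (fold (update_cell f) is z) = length z"
  by (induction "is" arbitrary: z) auto

text \<open>In \<open>rotate m z\<close> the cell to be updated stands in front and its cyclic left
  neighbour at the end, which is all that \<open>queue_step\<close> reads.\<close>

lemma rotate_update_cell:
  assumes "m < length z"
  shows "rotate (Suc m) (update_cell f m z) = queue_step f (rotate m z)"
proof -
  define a where "a = f (z ! (if m = 0 then length z - 1 else m - 1)) (z ! m)"
  have last: "last (rotate m z) = z ! (if m = 0 then length z - 1 else m - 1)"
    using assms by (cases z rule: rev_cases; cases m)
      (auto simp: rotate_drop_take take_Suc_conv_app_nth nth_append)
  have rot: "rotate m z = z ! m # drop (Suc m) z @ take m z"
    using assms by (simp add: rotate_drop_take Cons_nth_drop_Suc flip: append_Cons)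
  have "queue_step f (rotate m z) = drop (Suc m) z @ take m z @ [a]"
    unfolding queue_step_def last by (simp add: rot a_def)
  moreover have "rotate (Suc m) (z[m := a]) = drop (Suc m) z @ take m z @ [a]"
  \<comment> \<open>For the last cell the rotation is by the full length, which
    \<open>rotate_drop_take\<close> reduces to zero modulo \<open>length z\<close>.\<close>
  proof (cases "Suc m = length z")
    case True
    then show ?thesis
      using take_Suc_conv_app_nth[of m "z[m := a]"]
      by (simp add: rotate_drop_take del: rotate_Suc)
  next
    case False
    then show ?thesis
      using assms by (simp add: rotate_drop_take take_Suc_conv_app_nth del: rotate_Suc)
  qed
  ultimately show ?thesis
    by (simp add: update_cell_def a_def)
qed

lemma sequential_ca_queue: "sequential_ca f z = (queue_step f ^^ length z) z"
proof -
  have "rotate m (fold (update_cell f) [0..<m] z) = (queue_step f ^^ m) z" if "m \<le> length z" for m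
    using that
  proof (induction m)
    case (Suc m)
    then show ?case
      using rotate_update_cell[of m "fold (update_cell f) [0..<m] z" f]
      by (simp del: rotate_Suc)
  qed simp
  from this[of "length z"] show ?thesis
    by (simp add: sequential_ca_def rotate_drop_take)
qed

lemma length_queue_step: "L \<noteq> [] \<Longrightarrow> length (queue_step f L) = length L"
  by (simp add: queue_step_def)

lemma length_funpow_queue_step: "L \<noteq> [] \<Longrightarrow> length ((queue_step f ^^ m) L) = length L"
  by (induction m) (simp_all add: length_queue_step flip: length_greater_0_conv)

text \<open>A full sweep rotates by the whole length, hence not at all, so sweeps concatenate. The
  empty list is excluded because \<open>queue_step\<close> would lengthen it.\<close>

lemma funpow_sequential_ca_queue:
  assumes "z \<noteq> []"
  shows "(sequential_ca f ^^ k) z = (queue_step f ^^ (k * length z)) z"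
proof (induction k)
  case (Suc k)
  then show ?case
    using length_funpow_queue_step[OF assms] by (simp add: sequential_ca_queue funpow_add)
qed simp

section \<open>One pass of the head\<close>

fun symb_value :: "'s symb \<Rightarrow> 's option" where
  "symb_value (Letter t) = Some t"
| "symb_value (Inter c v M) = v"

text \<open>Letters carry neither counter, so \<open>\<not> has_counter c p\<close> covers the first
  round, over letters, and every later round, over symbols of the opposite counter.\<close>

fun has_counter :: "counter \<Rightarrow> 's symb \<Rightarrow> bool" where
  "has_counter c (Letter t) \<longleftrightarrow> False"
| "has_counter c (Inter c' v M) \<longleftrightarrow> c' = c"

lemma other_neq [simp]: "other c \<noteq> c" "c \<noteq> other c"
  by (cases c; simp)+

text \<open>By (R3) and (R4) the head blanks a value missing from its memory and stores it, and
  copies a value already stored; so each new letter loses exactly its first occurrence.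
  \<open>Q\<close> is arbitrary because the symbol just appended is the next head.\<close>

lemma queue_step_pass:
  assumes "last Q = Inter c v M" "Q \<noteq> []" "\<forall>p\<in>set P. \<not> has_counter c p"
  shows "\<exists>R v'. (queue_step (local_rule e) ^^ length P) (P @ Q) = Q @ R
     \<and> (\<forall>r\<in>set R. has_counter c r)
     \<and> last (Q @ R) = Inter c v' (M \<union> {t. Some t \<in> symb_value ` set P})
     \<and> (\<forall>t. count_list (map symb_value R) (Some t)
          = count_list (map symb_value P) (Some t) - (if t \<in> M then 0 else 1))"
  using assms
proof (induction P arbitrary: Q v M)
  case (Cons p P)
  define M' where "M' = M \<union> {t. symb_value p = Some t}"
  define w where "w = (case symb_value p of None \<Rightarrow> None
                        | Some t \<Rightarrow> if t \<in> M then Some t else None)"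
  have rule: "local_rule e (Inter c v M) p = Inter c w M'"
    using Cons.prems(3)
    by (cases p) (auto simp: M'_def w_def split: option.splits)
  have step: "queue_step (local_rule e) ((p # P) @ Q) = P @ (Q @ [Inter c w M'])"
    using Cons.prems rule by simp
  obtain R v' where R:
      "(queue_step (local_rule e) ^^ length P) (P @ (Q @ [Inter c w M'])) = (Q @ [Inter c w M']) @ R"
      "\<forall>r\<in>set R. has_counter c r"
      "last ((Q @ [Inter c w M']) @ R) = Inter c v' (M' \<union> {t. Some t \<in> symb_value ` set P})"
      "\<And>t. count_list (map symb_value R) (Some t)
          = count_list (map symb_value P) (Some t) - (if t \<in> M' then 0 else 1)"
    using Cons.IH[of "Q @ [Inter c w M']" w M'] Cons.prems(3) by auto
  have "(queue_step (local_rule e) ^^ length (p # P)) ((p # P) @ Q) = Q @ (Inter c w M' # R)"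
    using R(1) step by (simp add: funpow_Suc_right del: funpow.simps)
  moreover have "M' \<union> {t. Some t \<in> symb_value ` set P} = M \<union> {t. Some t \<in> symb_value ` set (p # P)}"
    by (auto simp: M'_def)
  moreover have "count_list (map symb_value (Inter c w M' # R)) (Some t)
      = count_list (map symb_value (p # P)) (Some t) - (if t \<in> M then 0 else 1)" for t
    using R(4)[of t] by (auto simp: M'_def w_def split: option.splits)
  ultimately show ?case
    using R(2,3) by (intro exI[of _ "Inter c w M' # R"] exI[of _ v']) auto
qed auto

text \<open>By (R6) a letter at the end of the queue replaces each intermediate symbol and is itself
  the next head.\<close>

lemma queue_step_overwrite:
  assumes "\<forall>p\<in>set P. has_counter c p" "last Q = Letter s" "Q \<noteq> []"
  shows "(queue_step (local_rule e) ^^ length P) (P @ Q) = Q @ replicate (length P) (Letter s)"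
  using assms
proof (induction P arbitrary: Q)
  case (Cons p P)
  then have "queue_step (local_rule e) ((p # P) @ Q) = P @ (Q @ [Letter s])"
    by (cases p) auto
  then show ?case
    using Cons.IH[of "Q @ [Letter s]"] Cons.prems
    by (simp add: funpow_Suc_right del: funpow.simps)
qed simp

section \<open>Iteration of rounds\<close>

lemma mem_symb_value_iff_count:
  "Some t \<in> symb_value ` set P \<longleftrightarrow> count_list (map symb_value P) (Some t) > 0"
  using count_notin[of "Some t" "map symb_value P"] count_list_0_iff[of "map symb_value P" "Some t"]
  by auto

text \<open>The hypotheses describe the end of round \<open>k + 1\<close>: the head meets the first
  cell of that round, which bears its own counter, so (R5) applies. Since \<open>s\<close> is in the
  memory, the unspecified values \<open>e\<close> never arise. The induction is on the lead
  \<open>count_list x s - k\<close>.\<close>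

lemma rounds_reach_majority:
  fixes x :: "'s::finite list"
  assumes maj: "\<And>t. t \<noteq> s \<Longrightarrow> count_list x t < count_list x s"
    and "\<forall>r\<in>set R. has_counter c r"
    and "last (Inter c None M\<^sub>0 # R) = Inter c v {t. k < count_list x t}"
    and "\<And>t. count_list (map symb_value R) (Some t) = count_list x t - Suc k"
    and "k < count_list x s"
  shows "\<exists>m. (queue_step (local_rule e) ^^ m) (Inter c None M\<^sub>0 # R)
               = replicate (Suc (length R)) (Letter s)"
  using assms(2-)
proof (induction "count_list x s - k" arbitrary: k c M\<^sub>0 R v rule: less_induct)
  case less
  let ?F = "queue_step (local_rule e)"
  let ?M = "{t. k < count_list x t}"
  have "s \<in> ?M"
    using less.prems by simp
  show ?case
  proof (cases "?M = {s}")
    case True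
    then have "?F (Inter c None M\<^sub>0 # R) = R @ [Letter s]"
      using less.prems(2) by simp
    moreover have "(?F ^^ length R) (R @ [Letter s]) = replicate (Suc (length R)) (Letter s)"
      using queue_step_overwrite[OF less.prems(1), of "[Letter s]"] by simp
    ultimately show ?thesis
      by (intro exI[of _ "Suc (length R)"]) (simp add: funpow_Suc_right del: funpow.simps)
  next
    case False
    \<comment> \<open>A rival \<open>t\<close> in the memory yields both facts for another round:
      \<open>s\<close> has an occurrence left, and the memory has two elements, so (R5) resets the
      head with the other counter.\<close>
    then obtain t where t: "t \<noteq> s" "k < count_list x t"
      using \<open>s \<in> ?M\<close> by blast
    then have "Suc k < count_list x s"
      using maj[of t] by simp
    have "card {s, t} \<le> card ?M"
      using t \<open>s \<in> ?M\<close> by (intro card_mono) auto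
    then have step: "?F (Inter c None M\<^sub>0 # R) = R @ [Inter (other c) None {}]"
      using less.prems(2) t by simp
    have "\<not> has_counter (other c) r" if "r \<in> set R" for r
      using less.prems(1) that by (cases r) auto
    then obtain R' v' where R':
        "(?F ^^ length R) (R @ [Inter (other c) None {}]) = Inter (other c) None {} # R'"
        "\<forall>r\<in>set R'. has_counter (other c) r"
        "last (Inter (other c) None {} # R') = Inter (other c) v' {t. Some t \<in> symb_value ` set R}"
        "\<And>t. count_list (map symb_value R') (Some t) = count_list (map symb_value R) (Some t) - 1"
      using queue_step_pass[of "[Inter (other c) None {}]" "other c" None "{}" R e] by auto
    have run: "(?F ^^ Suc (length R)) (Inter c None M\<^sub>0 # R) = Inter (other c) None {} # R'"
      using R'(1) step by (simp add: funpow_Suc_right del: funpow.simps)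
    from arg_cong[OF this, of length] have len: "length R' = length R"
      by (simp add: length_funpow_queue_step del: funpow.simps)
    have "{t. Some t \<in> symb_value ` set R} = {t. Suc k < count_list x t}"
      unfolding mem_symb_value_iff_count less.prems(3) by auto
    then have "\<exists>m. (?F ^^ m) (Inter (other c) None {} # R') = replicate (Suc (length R')) (Letter s)"
      using R'(2-4) less.prems(3) \<open>Suc k < count_list x s\<close>
      by (intro less.hyps[of "Suc k" R' "other c" "{}" v']) auto
    then obtain m where "(?F ^^ m) (Inter (other c) None {} # R') = replicate (Suc (length R')) (Letter s)"
      by blast
    then have "(?F ^^ (m + Suc (length R))) (Inter c None M\<^sub>0 # R) = replicate (Suc (length R)) (Letter s)"
      unfolding funpow_add comp_apply run len .
    then show ?thesis
      by blast
  qed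
qed

section \<open>Creation of the head\<close>

text \<open>The second case is a rotation of x whose first letter differs from its left neighbour.\<close>

lemma letters_rotate_or_const:
  fixes x :: "'s::finite list"
  assumes "x \<noteq> []"
  shows "x = replicate (length x) (hd x)
     \<or> (\<exists>m a y. (queue_step (local_rule e) ^^ m) (map Letter x) = map Letter (a # y)
              \<and> last (a # y) \<noteq> a \<and> count_list (a # y) = count_list x)"
proof (rule disjCI)
  let ?F = "queue_step (local_rule e)"
  assume no: "\<not> (\<exists>m a y. (?F ^^ m) (map Letter x) = map Letter (a # y)
              \<and> last (a # y) \<noteq> a \<and> count_list (a # y) = count_list x)"
  \<comment> \<open>As long as the two letters compared agree, (R1) makes a step a mere rotation;
    without a mismatch this continues forever.\<close>
  have rot: "(?F ^^ m) (map Letter x) = map Letter (rotate m x) \<and> count_list (rotate m x) = count_list x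
      \<and> last (rotate m x) = hd (rotate m x)" for m
  proof (induction m)
    case 0
    obtain a y where ay: "x = a # y"
      using assms by (cases x) auto
    have "(?F ^^ 0) (map Letter x) = map Letter (a # y)" "count_list (a # y) = count_list x"
      by (simp_all add: ay)
    then have "last (a # y) = a"
      using no by blast
    then show ?case
      by (simp add: ay)
  next
    case (Suc m)
    obtain a y where ay: "rotate m x = a # y"
      using assms by (cases "rotate m x") auto
    then have IH: "(?F ^^ m) (map Letter x) = map Letter (a # y)" "count_list (a # y) = count_list x"
        "last (a # y) = a"
      using Suc unfolding ay by (simp_all del: count_list.simps last.simps)
    have run: "(?F ^^ Suc m) (map Letter x) = map Letter (y @ [a])"
      using IH(1,3) last_map[of "a # y" Letter] by simp
    have count: "count_list (y @ [a]) = count_list x"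
      unfolding IH(2)[symmetric] by auto
    obtain b w where bw: "y @ [a] = b # w"
      by (cases "y @ [a]") auto
    have "last (b # w) = b"
      using no run count unfolding bw by blast
    then show ?case
      using run count by (simp add: ay bw)
  qed
  have "hd (rotate m x) = hd x" for m
  proof (induction m)
    case (Suc m)
    obtain a y where "rotate m x = a # y"
      using assms by (cases "rotate m x") auto
    then show ?case
      \<comment> \<open>The old first letter is now last, and by \<open>rot\<close> it equals the
        new first letter.\<close>
      using Suc rot[of "Suc m"] by simp
  qed simp
  then have "x ! m = hd x" if "m < length x" for m
    using hd_rotate_conv_nth[OF assms, of m] that by simp
  then show "x = replicate (length x) (hd x)"
    by (intro nth_equalityI) auto
qed

lemma letters_reach_majority:
  fixes x :: "'s::finite list"
  assumes "x \<noteq> []" and maj: "\<And>t. t \<noteq> s \<Longrightarrow> count_list x t < count_list x s"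
  shows "\<exists>m. (queue_step (local_rule e) ^^ m) (map Letter x) = replicate (length x) (Letter s)"
  using letters_rotate_or_const[OF assms(1), of e]
proof
  assume const: "x = replicate (length x) (hd x)"
  have "hd x = s"
  proof (rule ccontr)
    assume "hd x \<noteq> s"
    then have "s \<notin> set x"
      using const by (metis in_set_replicate)
    then show False
      using maj[OF \<open>hd x \<noteq> s\<close>] by simp
  qed
  then have "map Letter x = replicate (length x) (Letter s)"
    using const by (metis map_replicate)
  then show ?thesis
    by (intro exI[of _ 0]) simp
next
  let ?F = "queue_step (local_rule e)"
  assume "\<exists>m a y. (?F ^^ m) (map Letter x) = map Letter (a # y)
              \<and> last (a # y) \<noteq> a \<and> count_list (a # y) = count_list x"
  then obtain m a y where m: "(?F ^^ m) (map Letter x) = map Letter (a # y)" "last (a # y) \<noteq> a"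
      and count: "count_list (a # y) = count_list x"
    by blast
  from arg_cong[OF m(1), of length] have len: "length x = Suc (length y)"
    using assms(1) by (simp add: length_funpow_queue_step)
  \<comment> \<open>(R2) blanks \<open>a\<close> and records it: the new head has already treated
    the first cell of round one.\<close>
  let ?Q = "[Inter White None {a}]"
  have step: "?F (map Letter (a # y)) = map Letter y @ ?Q"
    using m(2) last_map[of "a # y" Letter] by simp
  obtain R v where R:
      "(?F ^^ length y) (map Letter y @ ?Q) = Inter White None {a} # R"
      "\<forall>r\<in>set R. has_counter White r"
      "last (Inter White None {a} # R)
         = Inter White v ({a} \<union> {t. Some t \<in> symb_value ` set (map Letter y)})"
      "\<And>t. count_list (map symb_value R) (Some t)
         = count_list (map symb_value (map Letter y)) (Some t) - (if t = a then 0 else 1)"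
    using queue_step_pass[of ?Q White None "{a}" "map Letter y" e] by auto
  from arg_cong[OF R(1), of length] have lenR: "length R = length y"
    by (simp add: length_funpow_queue_step)
  have vals: "count_list (map symb_value (map Letter y)) (Some t) = count_list y t" for t
    by (induction y) auto
  have mem: "{a} \<union> {t. Some t \<in> symb_value ` set (map Letter y)} = {t. 0 < count_list x t}"
    unfolding mem_symb_value_iff_count vals by (auto simp flip: count)
  \<comment> \<open>For \<open>t = a\<close> the lost occurrence is the cell turned into the head;
    any other letter loses one within \<open>y\<close>.\<close>
  have survivors: "count_list (map symb_value R) (Some t) = count_list x t - Suc 0" for t
    unfolding R(4) vals by (simp flip: count)
  have "0 < count_list x s"
    using maj[of a] count_list_0_iff[of x s] by (cases "a = s") (auto simp flip: count)
  then obtain m' where m': "(?F ^^ m') (Inter White None {a} # R) = replicate (Suc (length R)) (Letter s)"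
    using rounds_reach_majority[OF maj R(2) R(3)[unfolded mem] survivors] by blast
  have "(?F ^^ (m' + (length y + (1 + m)))) (map Letter x) = replicate (length x) (Letter s)"
    unfolding funpow_add comp_apply m(1) using step R(1) m' by (simp add: len lenR)
  then show ?thesis
    by blast
qed

lemma queue_step_const:
  assumes "0 < n"
  shows "(queue_step (local_rule e) ^^ m) (replicate n (Letter s)) = replicate n (Letter s)"
proof (induction m)
  case (Suc m)
  then show ?case
    using assms by (cases n) (auto simp: replicate_append_same)
qed simp

theorem theorem2:
  fixes e :: "counter \<Rightarrow> 's::finite option \<Rightarrow> 's option \<Rightarrow> 's set \<Rightarrow> 's symb"
    and n :: nat and x :: "'s list" and s :: 's
  assumes "n \<ge> 1" and "length x = n"
    and "\<And>t. t \<noteq> s \<Longrightarrow> count_list x s > count_list x t"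
  shows "(\<exists>K. \<forall>k\<ge>K. (sequential_ca (local_rule e) ^^ k) (map Letter x) = replicate n (Letter s))
       \<and> sequential_ca (local_rule e) (replicate n (Letter s)) = replicate n (Letter s)"
proof
  let ?F = "queue_step (local_rule e)"
  have "x \<noteq> []"
    using assms by auto
  then obtain m where m: "(?F ^^ m) (map Letter x) = replicate n (Letter s)"
    using letters_reach_majority[OF _ assms(3)] assms(2) by blast
  \<comment> \<open>\<open>K = m\<close> suffices: \<open>k\<close> sweeps are \<open>k * n\<close>
    queue steps, at least \<open>m\<close> of them, and the constant queue is stable.\<close>
  have "(sequential_ca (local_rule e) ^^ k) (map Letter x) = replicate n (Letter s)" if "m \<le> k" for k
  proof -
    have "m \<le> k * n"
      using that assms(1) by (metis mult_le_mono nat_mult_1_right)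
    then have "(?F ^^ (k * n)) (map Letter x) = (?F ^^ (k * n - m)) ((?F ^^ m) (map Letter x))"
      by (metis comp_apply funpow_add le_add_diff_inverse2)
    also have "\<dots> = replicate n (Letter s)"
      using assms(1) by (simp add: m queue_step_const)
    finally show ?thesis
      using \<open>x \<noteq> []\<close> assms(2) by (simp add: funpow_sequential_ca_queue)
  qed
  then show "\<exists>K. \<forall>k\<ge>K. (sequential_ca (local_rule e) ^^ k) (map Letter x) = replicate n (Letter s)"
    by blast
  show "sequential_ca (local_rule e) (replicate n (Letter s)) = replicate n (Letter s)"
    using assms(1) by (simp add: sequential_ca_queue queue_step_const)
qed

end
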